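(* Let $\mathfrak g$ be a simple finite-dimensional complex Lie algebra and let $\mathfrak f\subseteq\mathfrak g$ be a saturated Frobenius subalgebra. If $F\in\mathfrak f^*$ is a Frobenius functional on $\mathfrak f$, then its principal element $\widehat F\in\mathfrak f$ is semisimple (as an element of $\mathfrak g$).
   Context: All Lie algebras are finite-dimensional over $\mathbb C$. For a Lie algebra $\mathfrak f$ and $F\in\mathfrak f^*$, let $B_F(x,y)=F([x,y])$, a skew-symmetric bilinear form on $\mathfrak f$. $F$ is a Frobenius functional if $B_F$ is non-degenerate, and $\mathfrak f$ is Frobenius if it has a Frobenius functional. If $F$ is a Frobenius functional, the principal element of $F$ is the unique $\widehat F\in\mathfrak f$ such that $F(x)=F([\widehat F,x])$ for all $x\in\mathfrak f$. A Frobenius subalgebra $\mathfrak f$ of a simple Lie algebra $\mathfrak g$ is saturated if $\mathfrak f$ is not an ideal of any strictly larger subalgebra of $\mathfrak g$. *)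

theory Defs
  imports Complex_Main
begin

text \<open>
  A finite-dimensional complex Lie algebra whose carrier is a whole type. The additive structure
  comes from the type class; the scalar multiplication and the bracket are parameters.
\<close>

locale complex_lie_algebra = vector_space scale
  for scale :: "complex \<Rightarrow> 'a::ab_group_add \<Rightarrow> 'a" (infixr "*s" 75) +
  fixes bracket :: "'a \<Rightarrow> 'a \<Rightarrow> 'a"
  assumes finite_dimensional: "\<exists>Basis. finite_dimensional_vector_space scale Basis"
    and linear_bracket_left: "Vector_Spaces.linear scale scale (\<lambda>x. bracket x y)"
    and linear_bracket_right: "Vector_Spaces.linear scale scale (bracket x)"
    and bracket_self: "bracket x x = 0"
    and jacobi: "bracket x (bracket y z) + bracket y (bracket z x) + bracket z (bracket x y) = 0"
begin

definition lie_subalgebra :: "'a set \<Rightarrow> bool" where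
  "lie_subalgebra \<ff> \<longleftrightarrow> subspace \<ff> \<and> (\<forall>x\<in>\<ff>. \<forall>y\<in>\<ff>. bracket x y \<in> \<ff>)"

definition ideal_of :: "'a set \<Rightarrow> 'a set \<Rightarrow> bool" where
  "ideal_of I \<hh> \<longleftrightarrow> lie_subalgebra \<hh> \<and> subspace I \<and> I \<subseteq> \<hh> \<and> (\<forall>x\<in>\<hh>. \<forall>y\<in>I. bracket x y \<in> I)"

text \<open>
  Elements of the dual of a subspace are represented by functions on the whole type that are
  linear on the subspace; their values outside it are irrelevant.
\<close>

definition linear_functional_on :: "'a set \<Rightarrow> ('a \<Rightarrow> complex) \<Rightarrow> bool" where
  "linear_functional_on V F \<longleftrightarrow>
     (\<forall>x\<in>V. \<forall>y\<in>V. F (x + y) = F x + F y) \<and> (\<forall>c. \<forall>x\<in>V. F (c *s x) = c * F x)"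

definition kirillov_form :: "('a \<Rightarrow> complex) \<Rightarrow> 'a \<Rightarrow> 'a \<Rightarrow> complex" where
  "kirillov_form F x y = F (bracket x y)"

text \<open>
  One-sided non-degeneracy suffices, as the definition is only applied to skew-symmetric forms on
  finite-dimensional spaces.
\<close>

definition nondegenerate_on :: "'a set \<Rightarrow> ('a \<Rightarrow> 'a \<Rightarrow> complex) \<Rightarrow> bool" where
  "nondegenerate_on V B \<longleftrightarrow> (\<forall>x\<in>V. (\<forall>y\<in>V. B x y = 0) \<longrightarrow> x = 0)"

definition frobenius_functional :: "'a set \<Rightarrow> ('a \<Rightarrow> complex) \<Rightarrow> bool" where
  "frobenius_functional \<ff> F \<longleftrightarrow> linear_functional_on \<ff> F \<and> nondegenerate_on \<ff> (kirillov_form F)"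

definition frobenius_subalgebra :: "'a set \<Rightarrow> bool" where
  "frobenius_subalgebra \<ff> \<longleftrightarrow> lie_subalgebra \<ff> \<and> (\<exists>F. frobenius_functional \<ff> F)"

definition saturated_frobenius_subalgebra :: "'a set \<Rightarrow> bool" where
  "saturated_frobenius_subalgebra \<ff> \<longleftrightarrow>
     frobenius_subalgebra \<ff> \<and> \<not> (\<exists>\<hh>. lie_subalgebra \<hh> \<and> \<ff> \<subset> \<hh> \<and> ideal_of \<ff> \<hh>)"

definition principal_element :: "'a set \<Rightarrow> ('a \<Rightarrow> complex) \<Rightarrow> 'a" where
  "principal_element \<ff> F = (THE h. h \<in> \<ff> \<and> (\<forall>x\<in>\<ff>. F x = F (bracket h x)))"

text \<open>
  Over the complex numbers an endomorphism is semisimple iff it is diagonalizable. For an element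
  of a simple Lie algebra, semisimplicity refers to its adjoint action on the whole algebra.
\<close>

definition diagonalizable :: "('a \<Rightarrow> 'a) \<Rightarrow> bool" where
  "diagonalizable T \<longleftrightarrow> (\<exists>B. independent B \<and> span B = UNIV \<and> (\<forall>b\<in>B. \<exists>c. T b = c *s b))"

definition semisimple_element :: "'a \<Rightarrow> bool" where
  "semisimple_element x \<longleftrightarrow> diagonalizable (bracket x)"

text \<open>The description in \<open>principal_element_def\<close> is proper for every Frobenius functional.\<close>

lemma principal_element_unique_existence:
  assumes sub: "lie_subalgebra \<ff>" and F: "frobenius_functional \<ff> F"
  shows "\<exists>!h. h \<in> \<ff> \<and> (\<forall>x\<in>\<ff>. F x = F (bracket h x))"
proof -
  obtain Basis where "finite_dimensional_vector_space scale Basis"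
    using finite_dimensional by blast
  then interpret fd: finite_dimensional_vector_space scale Basis .
  interpret fdp: finite_dimensional_vector_space_pair scale Basis scale Basis
    by unfold_locales
  interpret vp: vector_space_pair scale "(*) :: complex \<Rightarrow> complex \<Rightarrow> complex"
    by unfold_locales (auto simp: algebra_simps)
  have V: "subspace \<ff>" and cl: "\<And>x y. x \<in> \<ff> \<Longrightarrow> y \<in> \<ff> \<Longrightarrow> bracket x y \<in> \<ff>"
    using sub by (auto simp: lie_subalgebra_def)
  have Fadd: "\<And>x y. x \<in> \<ff> \<Longrightarrow> y \<in> \<ff> \<Longrightarrow> F (x + y) = F x + F y"
    and Fsc: "\<And>c x. x \<in> \<ff> \<Longrightarrow> F (c *s x) = c * F x"
    and nd: "\<And>x. x \<in> \<ff> \<Longrightarrow> (\<And>y. y \<in> \<ff> \<Longrightarrow> F (bracket x y) = 0) \<Longrightarrow> x = 0"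
    using F by (auto simp: frobenius_functional_def linear_functional_on_def nondegenerate_on_def
        kirillov_form_def)
  obtain B where B: "B \<subseteq> \<ff>" "independent B" "\<ff> \<subseteq> span B"
    using maximal_independent_subset by blast
  have fB: "finite B"
    using B(2) by (rule fd.finiteI_independent)
  have spB: "span B = \<ff>"
    using B V by (simp add: span_subspace)
  obtain G where G: "Vector_Spaces.linear scale (*) G" and GB: "\<And>b. b \<in> B \<Longrightarrow> G b = F b"
    using vp.linear_independent_extend[OF B(2)] by blast
  interpret G: Vector_Spaces.linear scale "(*)" G by (rule G)
  have GF: "G x = F x" if "x \<in> \<ff>" for x
  proof -
    have "x \<in> span B" using that spB by simp
    then have "G x = F x \<and> x \<in> \<ff>"
    proof (induction rule: span_induct_alt)
      case base
      show ?case using Fsc[of 0 0] V by (simp add: G.zero subspace_0)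
    next
      case (step c b y)
      then show ?case
        using B V by (auto simp: G.add G.scale GB Fadd Fsc subspace_scale subspace_add subsetD)
    qed
    then show ?thesis ..
  qed
  have lin_left: "bracket (x + y) z = bracket x z + bracket y z"
    "bracket (c *s x) z = c *s bracket x z" for x y z c
    using linear_bracket_left[of z] by (auto simp: Vector_Spaces.linear_iff)
  have lin_right: "bracket z (x + y) = bracket z x + bracket z y"
    "bracket z (c *s x) = c *s bracket z x" for x y z c
    using linear_bracket_right[of z] by (auto simp: Vector_Spaces.linear_iff)
  have Glin: "Vector_Spaces.linear scale (*) (\<lambda>x. G (bracket h x))" for h
    using vp.vs2.vector_space_axioms vector_space_axioms
    by (auto simp: Vector_Spaces.linear_iff lin_right G.add G.scale)
  have ext: "F (bracket h x) = F (bracket k x)" if "h \<in> \<ff>" "k \<in> \<ff>" "x \<in> \<ff>"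
    "\<And>b. b \<in> B \<Longrightarrow> G (bracket h b) = G (bracket k b)" for h k x
    using vp.linear_eq_on[OF Glin Glin, of x B h k] that spB by (simp add: GF cl)
  define T where "T h = (\<Sum>b\<in>B. G (bracket h b) *s b)" for h
  have T: "Vector_Spaces.linear scale scale T"
    using vector_space_axioms
    by (auto simp: Vector_Spaces.linear_iff T_def lin_left G.add G.scale scale_left_distrib
        sum.distrib scale_sum_right)
  have coeff: "u b = v b" if "(\<Sum>b\<in>B. u b *s b) = (\<Sum>b\<in>B. v b *s b)" "b \<in> B" for u v b
    using independentD[OF B(2) fB order_refl, of "\<lambda>b. u b - v b" b] that
    by (simp add: scale_left_diff_distrib sum_subtractf)
  have eqI: "h = k" if "h \<in> \<ff>" "k \<in> \<ff>" "\<And>x. x \<in> \<ff> \<Longrightarrow> F (bracket h x) = F (bracket k x)" for h k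
  proof -
    have "F (bracket (h - k) y) = 0" if y: "y \<in> \<ff>" for y
    proof -
      have "F (bracket h y) = F (bracket (h - k) y + bracket k y)"
        by (simp flip: lin_left)
      also have "\<dots> = F (bracket (h - k) y) + F (bracket k y)"
        using \<open>h \<in> \<ff>\<close> \<open>k \<in> \<ff>\<close> y V by (intro Fadd cl) (auto intro: subspace_diff)
      finally show ?thesis using \<open>\<And>x. x \<in> \<ff> \<Longrightarrow> F (bracket h x) = F (bracket k x)\<close>[OF y]
        by simp
    qed
    then have "h - k = 0"
      using \<open>h \<in> \<ff>\<close> \<open>k \<in> \<ff>\<close> V by (intro nd) (auto intro: subspace_diff)
    then show ?thesis by simp
  qed
  have inj: "inj_on T (span \<ff>)"
  proof (rule inj_onI)
    fix h k assume "h \<in> span \<ff>" "k \<in> span \<ff>" and eq: "T h = T k"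
    then have hk: "h \<in> \<ff>" "k \<in> \<ff>" using V by (simp_all add: span_eq_iff[THEN iffD2])
    have "G (bracket h b) = G (bracket k b)" if "b \<in> B" for b
      using coeff[OF eq[unfolded T_def] that] .
    then show "h = k" using hk by (intro eqI ext) auto
  qed
  have "T ` \<ff> = \<ff>"
  proof (rule fd.subspace_dim_equal)
    show "subspace (T ` \<ff>)"
      using T V by (simp add: fdp.linear_subspace_image)
    show "T ` \<ff> \<subseteq> \<ff>"
      using B V by (auto simp: T_def intro!: subspace_sum subspace_scale)
    show "dim \<ff> \<le> dim (T ` \<ff>)"
      using fdp.dim_image_eq[OF T inj] by simp
  qed (rule V)
  moreover have "(\<Sum>b\<in>B. F b *s b) \<in> \<ff>"
    using B V by (auto intro!: subspace_sum subspace_scale)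
  ultimately obtain h where h: "h \<in> \<ff>" "T h = (\<Sum>b\<in>B. F b *s b)"
    by (metis imageE)
  have "G (bracket h b) = G b" if "b \<in> B" for b
    using coeff[OF h(2)[unfolded T_def] that] GB[OF that] by simp
  then have "F (bracket h x) = F x" if "x \<in> \<ff>" for x
    using vp.linear_eq_on[OF Glin G, of x B h] that spB h(1) by (simp add: GF cl)
  with h(1) show ?thesis
    by (intro ex1I[of _ h]) (auto intro: eqI)
qed

end

locale simple_complex_lie_algebra = complex_lie_algebra +
  assumes nonabelian: "\<exists>x y. bracket x y \<noteq> 0"
    and ideal_trivial: "ideal_of I UNIV \<Longrightarrow> I = {0} \<or> I = UNIV"

end

theory Submission
  imports Defs "HOL-Computational_Algebra.Fundamental_Theorem_Algebra"
begin

text \<open>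
  Let \<open>x\<close> be the principal element and let \<open>S\<close> be the semisimple part of \<open>ad x\<close>, that is,
  multiplication by \<open>c\<close> on the generalized eigenspace for \<open>c\<close>. It is a derivation, hence inner,
  say \<open>S = ad s\<close>. As \<open>S\<close> preserves every \<open>ad x\<close>-stable subspace, \<open>s\<close> normalizes \<open>\<ff>\<close>, so
  \<open>s \<in> \<ff>\<close> by saturation. The functional \<open>F\<close> is fixed by the transpose of \<open>ad x\<close> on \<open>\<ff>\<close>, so it
  vanishes on the generalized eigenspaces for \<open>c \<noteq> 1\<close> and is fixed by the transpose of \<open>S\<close> too.
  Uniqueness of the principal element gives \<open>s = x\<close>, whence \<open>ad x = S\<close> is diagonalizable.

  Derivations are inner because the Killing form is non-degenerate. Otherwise it would vanish
  identically by simplicity; then the trace of \<open>D \<circ> ad x\<close> vanishes for every derivation \<open>D\<close>, as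
  \<open>\<gg> = [\<gg>, \<gg>]\<close>. With \<open>D\<close> the multiplication by the conjugate of \<open>c\<close> on the generalized
  eigenspaces, this trace is the sum of the squared moduli of the eigenvalues, so every \<open>ad x\<close> is
  nilpotent, and Engel's theorem yields a non-trivial centre.
\<close>

section \<open>Generalized eigenspaces\<close>

locale complex_fd_space = finite_dimensional_vector_space scale Basis
  for scale :: "complex \<Rightarrow> 'a::ab_group_add \<Rightarrow> 'a" (infixr "*s" 75) and Basis
begin

sublocale pair: finite_dimensional_vector_space_pair scale Basis scale Basis
  by unfold_locales

abbreviation endo :: "('a \<Rightarrow> 'a) \<Rightarrow> bool" where
  "endo \<equiv> Vector_Spaces.linear scale scale"

lemma endo_iff: "endo T \<longleftrightarrow> (\<forall>x y. T (x + y) = T x + T y) \<and> (\<forall>c x. T (c *s x) = c *s T x)"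
  using vector_space_axioms by (auto simp: Vector_Spaces.linear_iff)

lemma
  assumes "endo T"
  shows endo_add: "T (x + y) = T x + T y" and endo_scale: "T (c *s x) = c *s T x"
    and endo_zero: "T 0 = 0" and endo_diff: "T (x - y) = T x - T y"
    and endo_sum: "T (sum f A) = (\<Sum>a\<in>A. T (f a))"
proof -
  interpret T: Vector_Spaces.linear scale scale T by fact
  show "T (x + y) = T x + T y" "T (c *s x) = c *s T x" "T 0 = 0" "T (x - y) = T x - T y"
    "T (sum f A) = (\<Sum>a\<in>A. T (f a))"
    by (rule T.add T.scale T.zero T.diff T.sum)+
qed

lemma endo_span_stable:
  assumes "endo T" "\<And>b. b \<in> B \<Longrightarrow> T b \<in> span B" "v \<in> span B"
  shows "T v \<in> span B"
  using assms(3)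
  by (induction rule: span_induct_alt)
    (auto simp: endo_zero[OF assms(1)] endo_add[OF assms(1)] endo_scale[OF assms(1)]
      span_zero intro!: span_add span_scale assms(2))

definition shift :: "('a \<Rightarrow> 'a) \<Rightarrow> complex \<Rightarrow> 'a \<Rightarrow> 'a" where
  "shift T c v = T v - c *s v"

lemma endo_shift: "endo T \<Longrightarrow> endo (shift T c)"
  by (auto simp: endo_iff shift_def algebra_simps)

lemma shift_commute: "endo T \<Longrightarrow> shift T c (shift T d v) = shift T d (shift T c v)"
  by (simp add: shift_def endo_diff endo_scale algebra_simps)

text \<open>These are the vectors killed by some power of \<open>T - c\<close>. The inductive form
  hides the exponent and gives induction along the iterates of \<open>shift T c\<close>.\<close>

inductive_set gen_eigenspace :: "('a \<Rightarrow> 'a) \<Rightarrow> complex \<Rightarrow> 'a set"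
  for T c where
  zero: "0 \<in> gen_eigenspace T c"
| step: "shift T c v \<in> gen_eigenspace T c \<Longrightarrow> v \<in> gen_eigenspace T c"

lemma shift_gen_eigenspace:
  assumes "endo T" "v \<in> gen_eigenspace T c"
  shows "shift T c v \<in> gen_eigenspace T c"
  using assms(2) by cases (auto simp: endo_zero[OF endo_shift[OF assms(1)]] intro: gen_eigenspace.zero)

lemma subspace_gen_eigenspace:
  assumes T: "endo T"
  shows "subspace (gen_eigenspace T c)"
proof (rule subspaceI)
  show "0 \<in> gen_eigenspace T c" by (rule gen_eigenspace.zero)
next
  fix x y assume "x \<in> gen_eigenspace T c" "y \<in> gen_eigenspace T c"
  then show "x + y \<in> gen_eigenspace T c"
  proof (induction arbitrary: y)
    case (step v)
    then show ?case
      by (metis T endo_add endo_shift gen_eigenspace.step shift_gen_eigenspace)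
  qed simp
next
  fix k x assume "x \<in> gen_eigenspace T c"
  then show "k *s x \<in> gen_eigenspace T c"
    by induction (auto intro: gen_eigenspace.intros simp: endo_scale[OF endo_shift[OF T]])
qed

text \<open>The iterates of \<open>T - c\<close> on \<open>v\<close> stay in \<open>V\<close> and
  end at 0, which lies in \<open>W\<close>; \<open>u\<close> is the last iterate outside
  \<open>W\<close>.\<close>

lemma gen_eigenspace_leave:
  assumes "v \<in> gen_eigenspace T c" "v \<notin> W" "v \<in> V" "0 \<in> W"
    "\<And>u. u \<in> V \<Longrightarrow> shift T c u \<in> V"
  obtains u where "u \<in> gen_eigenspace T c" "u \<in> V" "u \<notin> W" "shift T c u \<in> W"
  using assms(1-3)
proof (induction arbitrary: thesis)
  case zero
  then show ?case using assms(4) by blast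
next
  case (step v)
  then show ?case using assms(5) gen_eigenspace.step by blast
qed

text \<open>On the generalized eigenspace for \<open>d\<close>, \<open>T - c\<close> is a nilpotent
  map plus the non-zero scalar \<open>d - c\<close>. If \<open>u\<close> is a preimage of
  \<open>(T - d) v\<close>, then \<open>(T - c) (u - v) = (c - d) v\<close>, so rescaling
  \<open>u - v\<close> gives a preimage of \<open>v\<close>.\<close>

lemma shift_surj_gen_eigenspace:
  assumes T: "endo T" and U: "subspace U" "\<And>u. u \<in> U \<Longrightarrow> T u \<in> U" and ne: "c \<noteq> d"
    and v: "v \<in> gen_eigenspace T d" "v \<in> U"
  obtains u where "u \<in> gen_eigenspace T d" "u \<in> U" "shift T c u = v"
  using v
proof (induction arbitrary: thesis)
  case zero
  show ?case
    by (rule zero(1)[of 0]) (auto intro: gen_eigenspace.zero subspace_0 U simp: endo_zero endo_shift T)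
next
  case (step v)
  have "shift T d v \<in> U"
    using U step by (auto simp: shift_def intro: subspace_diff subspace_scale)
  then obtain u where u: "u \<in> gen_eigenspace T d" "u \<in> U" "shift T c u = shift T d v"
    using step.IH by blast
  have "shift T c (u - v) = (c - d) *s v"
    using u(3) by (simp add: endo_diff[OF endo_shift[OF T]]) (simp add: shift_def algebra_simps)
  then have "shift T c (inverse (c - d) *s (u - v)) = v"
    using ne by (simp add: endo_scale[OF endo_shift[OF T]])
  moreover have "u - v \<in> gen_eigenspace T d"
    using u(1) step.hyps subspace_diff subspace_gen_eigenspace[OF T] gen_eigenspace.step by blast
  ultimately show ?case
    using step.prems u U subspace_gen_eigenspace[OF T]
    by (meson subspace_diff subspace_scale)
qed

lemma shift_surj_span_gen_eigenspaces:
  assumes T: "endo T" and U: "subspace U" "\<And>u. u \<in> U \<Longrightarrow> T u \<in> U" and c: "c \<notin> D"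
    and v: "v \<in> span (\<Union>d\<in>D. gen_eigenspace T d \<inter> U)"
  obtains u where "u \<in> span (\<Union>d\<in>D. gen_eigenspace T d \<inter> U)" "shift T c u = v"
proof -
  have "\<exists>u \<in> span (\<Union>d\<in>D. gen_eigenspace T d \<inter> U). shift T c u = v"
    using v
  proof (induction rule: span_induct_alt)
    case base
    show ?case by (intro bexI[of _ 0]) (auto simp: endo_zero[OF endo_shift[OF T]] span_zero)
  next
    case (step k b y)
    then obtain d where d: "d \<in> D" "b \<in> gen_eigenspace T d" "b \<in> U" by blast
    then have "c \<noteq> d" using c by blast
    then obtain u where u: "u \<in> gen_eigenspace T d" "u \<in> U" "shift T c u = b"
      using shift_surj_gen_eigenspace[OF T U _ d(2,3)] by blast
    obtain w where w: "w \<in> span (\<Union>d\<in>D. gen_eigenspace T d \<inter> U)" "shift T c w = y"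
      using step by blast
    show ?case
    proof (intro bexI)
      show "shift T c (k *s u + w) = k *s b + y"
        by (simp add: u w endo_add[OF endo_shift[OF T]] endo_scale[OF endo_shift[OF T]])
      show "k *s u + w \<in> span (\<Union>d\<in>D. gen_eigenspace T d \<inter> U)"
        using u d w by (blast intro: span_add span_scale span_base)
    qed
  qed
  then show thesis using that by blast
qed

text \<open>A right inverse \<open>g\<close> of \<open>f\<close> is injective on \<open>R\<close>,
  so by dimension it maps \<open>R\<close> onto \<open>R\<close>. Writing \<open>x = g y\<close>
  gives \<open>y = f x = 0\<close>.\<close>

lemma surj_on_imp_ker_trivial:
  assumes f: "endo f" and R: "subspace R" and surj: "R \<subseteq> f ` R" and x: "x \<in> R" "f x = 0"
  shows "x = 0"
proof -
  obtain g where g: "g ` UNIV \<subseteq> R" "endo g" "\<forall>v\<in>f ` R. f (g v) = v"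
    using pair.linear_exists_right_inverse_on[OF f R] by blast
  have inj: "inj_on g (span R)"
    using g(3) surj R by (metis (no_types, lifting) inj_onI span_eq_iff subsetD)
  have "g ` R = R"
  proof (rule subspace_dim_equal)
    show "subspace (g ` R)" using g(2) R by (rule pair.linear_subspace_image)
    show "dim R \<le> dim (g ` R)" using pair.dim_image_eq[OF g(2) inj] by simp
  qed (use g R in auto)
  then obtain y where "y \<in> R" "x = g y" using x by blast
  then show ?thesis using g surj x endo_zero[OF g(2)] by (metis subsetD)
qed

text \<open>\<open>T - c\<close> maps the sum of the other generalized eigenspaces onto itself,
  hence is injective there, and so are its powers. One of these powers kills
  \<open>v\<close>.\<close>

lemma gen_eigenspace_inter_others:
  assumes T: "endo T" and v: "v \<in> gen_eigenspace T c"
    "v \<in> span (\<Union>d\<in>-{c}. gen_eigenspace T d)"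
  shows "v = 0"
proof -
  let ?R = "span (\<Union>d\<in>-{c}. gen_eigenspace T d)"
  have ker: "x = 0" if "x \<in> ?R" "shift T c x = 0" for x
  proof (rule surj_on_imp_ker_trivial[OF endo_shift[OF T] _ _ that])
    show "?R \<subseteq> shift T c ` ?R"
      using shift_surj_span_gen_eigenspaces[OF T subspace_UNIV UNIV_I, of c "-{c}"] by auto
  qed simp
  have stable: "shift T c x \<in> ?R" if "x \<in> ?R" for x
  proof (rule endo_span_stable[OF endo_shift[OF T] _ that])
    fix b assume "b \<in> (\<Union>d\<in>-{c}. gen_eigenspace T d)"
    then obtain d where d: "d \<noteq> c" "b \<in> gen_eigenspace T d" by blast
    have "shift T c b = shift T d b + (d - c) *s b"
      by (simp add: shift_def algebra_simps)
    also have "\<dots> \<in> gen_eigenspace T d"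
      using d by (intro subspace_add subspace_scale subspace_gen_eigenspace[OF T] shift_gen_eigenspace[OF T])
    finally show "shift T c b \<in> ?R" using d by (intro span_base) blast
  qed
  from v show ?thesis
    by induction (use ker stable in blast)+
qed

text \<open>Split \<open>v = x + y\<close> along the vectors of \<open>B\<close> inside and outside
  the eigenspace. Then \<open>y = v - x\<close> lies in the eigenspace and in the sum of the others,
  so it vanishes.\<close>

lemma gen_eigenspace_inter_span:
  assumes T: "endo T" and B: "B \<subseteq> (\<Union>d. gen_eigenspace T d)"
    and v: "v \<in> span B" "v \<in> gen_eigenspace T c"
  shows "v \<in> span (B \<inter> gen_eigenspace T c)"
proof -
  have "B = B \<inter> gen_eigenspace T c \<union> (B - gen_eigenspace T c)" by blast
  with v obtain x y where xy: "v = x + y" "x \<in> span (B \<inter> gen_eigenspace T c)"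
    "y \<in> span (B - gen_eigenspace T c)"
    using span_Un[of "B \<inter> gen_eigenspace T c" "B - gen_eigenspace T c"] by auto
  have "x \<in> gen_eigenspace T c"
    using xy(2) span_minimal[OF _ subspace_gen_eigenspace[OF T]] by blast
  then have "y \<in> gen_eigenspace T c"
    using v(2) xy(1) subspace_diff[OF subspace_gen_eigenspace[OF T]] by force
  moreover have "y \<in> span (\<Union>d\<in>-{c}. gen_eigenspace T d)"
  proof (rule subsetD[OF span_mono xy(3)], rule subsetI)
    fix b assume b: "b \<in> B - gen_eigenspace T c"
    with B obtain d where "b \<in> gen_eigenspace T d" by blast
    with b show "b \<in> (\<Union>d\<in>-{c}. gen_eigenspace T d)" by auto
  qed
  ultimately have "y = 0" by (rule gen_eigenspace_inter_others[OF T])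
  then show ?thesis using xy by simp
qed

lemma gen_eigenvalue_unique:
  assumes "endo T" "v \<in> gen_eigenspace T c" "v \<in> gen_eigenspace T d" "v \<noteq> 0"
  shows "c = d"
  using gen_eigenspace_inter_others[OF assms(1,2)] assms(3,4) by (blast intro: span_base)

lemma ex_annihilating_coeffs:
  obtains a n where "\<exists>i\<le>n. a i \<noteq> 0" "(\<Sum>i\<le>n. a i *s (T ^^ i) v) = 0"
proof (cases "inj_on (\<lambda>i. (T ^^ i) v) {..dimension}")
  case True
  let ?f = "\<lambda>i. (T ^^ i) v"
  have "card (?f ` {..dimension}) > dimension"
    using card_image[OF True] by simp
  then have "dependent (?f ` {..dimension})"
    using independent_bound_general[of "?f ` {..dimension}"] dim_subset_UNIV[of "?f ` {..dimension}"]
    by fastforce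
  then obtain u where u: "\<exists>w\<in>?f ` {..dimension}. u w \<noteq> 0" "(\<Sum>w\<in>?f ` {..dimension}. u w *s w) = 0"
    by (auto simp: dependent_finite)
  show ?thesis
    by (rule that[of dimension "\<lambda>i. u (?f i)"]) (use u sum.reindex[OF True, of "\<lambda>w. u w *s w"] in auto)
next
  \<comment> \<open>Coinciding powers collapse in the set of iterates, which may then be
    independent; the relation is instead the difference of the two equal terms.\<close>
  case False
  then obtain i j where ij: "i \<le> dimension" "j \<le> dimension" "i \<noteq> j" "(T ^^ i) v = (T ^^ j) v"
    by (auto simp: inj_on_def)
  let ?a = "\<lambda>k. (if k = i then 1 else 0) - (if k = j then 1 else 0) :: complex"
  have "(\<Sum>k\<le>dimension. ?a k *s (T ^^ k) v) = 
    (\<Sum>k\<le>dimension. if k = i then (T ^^ k) v else 0) - (\<Sum>k\<le>dimension. if k = j then (T ^^ k) v else 0)"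
    unfolding sum_subtractf[symmetric] by (intro sum.cong) (auto simp: scale_left_diff_distrib)
  also have "\<dots> = 0" using ij by simp
  finally show ?thesis using ij by (intro that[of dimension ?a]) auto
qed

text \<open>Some non-zero polynomial in \<open>T\<close> kills \<open>v\<close>, and its linear
  factors are removed one at a time. The relative form for a stable \<open>U\<close> shows that
  \<open>U\<close> is the sum of its intersections with the generalized eigenspaces.\<close>

lemma span_gen_eigenspaces:
  assumes T: "endo T" and U: "subspace U" "\<And>u. u \<in> U \<Longrightarrow> T u \<in> U" and v: "v \<in> U"
  shows "v \<in> span (\<Union>c. gen_eigenspace T c \<inter> U)"
proof -
  let ?W = "span (\<Union>c. gen_eigenspace T c \<inter> U)"
  have WU: "?W \<subseteq> U" by (intro span_minimal U) auto
  have shiftU: "shift T c u \<in> U" if "u \<in> U" for c u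
    using U that by (auto simp: shift_def intro: subspace_diff subspace_scale)
  \<comment> \<open>\<open>T - c\<close> is onto on the eigenspaces for \<open>d \<noteq> c\<close>, so \<open>u\<close> can be corrected by an element of
    \<open>?W\<close> to a generalized eigenvector for \<open>c\<close>.\<close>
  have pull: "u \<in> ?W" if u: "u \<in> U" "shift T c u \<in> ?W" for c u
  proof -
    have "(\<Union>c. gen_eigenspace T c \<inter> U) =
        gen_eigenspace T c \<inter> U \<union> (\<Union>d\<in>-{c}. gen_eigenspace T d \<inter> U)" by blast
    then obtain x y where xy: "shift T c u = x + y" "x \<in> span (gen_eigenspace T c \<inter> U)"
      "y \<in> span (\<Union>d\<in>-{c}. gen_eigenspace T d \<inter> U)"
      using u(2) span_Un[of "gen_eigenspace T c \<inter> U"] by auto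
    have x: "x \<in> gen_eigenspace T c"
      using xy(2) span_minimal[OF _ subspace_gen_eigenspace[OF T]] by blast
    obtain w where w: "w \<in> span (\<Union>d\<in>-{c}. gen_eigenspace T d \<inter> U)" "shift T c w = y"
      using shift_surj_span_gen_eigenspaces[OF T U _ xy(3)] by blast
    have wW: "w \<in> ?W"
      by (rule subsetD[OF span_mono w(1)]) blast
    have "shift T c (u - w) = x"
      using w xy by (simp add: endo_diff[OF endo_shift[OF T]])
    then have "u - w \<in> gen_eigenspace T c \<inter> U"
      using x u wW WU U(1) by (auto intro: gen_eigenspace.step subspace_diff)
    then have "u - w \<in> ?W" by (blast intro: span_base)
    then show ?thesis using wW span_add by fastforce
  qed
  \<comment> \<open>Split off a root: if \<open>p = (X - c) q\<close> and \<open>p(T) u = 0\<close>,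
    then \<open>q(T)\<close> kills \<open>(T - c) u\<close>. By induction this vector lies in
    \<open>?W\<close>, and \<open>pull\<close> brings \<open>u\<close> there.\<close>
  have main: "u \<in> ?W"
    if "degree p \<le> n" "p \<noteq> 0" "u \<in> U" "(\<Sum>i\<le>n. coeff p i *s (T ^^ i) u) = 0" for n p u
    using that
  proof (induction n arbitrary: p u)
    case 0
    then have "u = 0" by (cases p) (auto split: if_splits)
    then show ?case by (simp add: span_zero)
  next
    case (Suc n)
    show ?case
    proof (cases "degree p = 0")
      case True
      then obtain a where p: "p = [:a:]" by (rule degree_eq_zeroE)
      have "(\<Sum>i\<le>n. coeff p (Suc i) *s (T ^^ Suc i) u) = 0" by (simp add: p)
      then have "u = 0"
        using Suc.prems p by (simp add: sum.atMost_Suc_shift del: sum.atMost_Suc)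
      then show ?thesis by (simp add: span_zero)
    next
      case False
      then obtain c where "poly p c = 0"
        using fundamental_theorem_of_algebra constant_degree by metis
      then obtain q where p: "p = [:-c, 1:] * q" by (auto simp: poly_eq_0_iff_dvd)
      with Suc.prems have q: "q \<noteq> 0" by auto
      have "degree p = Suc (degree q)" unfolding p using q by (subst degree_mult_eq) auto
      with Suc.prems have dq: "degree q \<le> n" by simp
      have cs: "coeff p (Suc i) = coeff q i - c * coeff q (Suc i)" "coeff p 0 = - c * coeff q 0" for i
        by (simp_all add: p)
      have Tpow: "(T ^^ i) (shift T c u) = (T ^^ Suc i) u - c *s (T ^^ i) u" for i
        by (induction i) (auto simp: shift_def endo_diff[OF T] endo_scale[OF T])
      have "(\<Sum>i\<le>n. coeff q i *s (T ^^ i) (shift T c u)) =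
          (\<Sum>i\<le>n. coeff q i *s (T ^^ Suc i) u) - c *s (\<Sum>i\<le>n. coeff q i *s (T ^^ i) u)"
        unfolding Tpow by (simp add: scale_right_diff_distrib sum_subtractf scale_sum_right mult.commute)
      \<comment> \<open>The added term is 0 because \<open>degree q \<le> n\<close>; with it the
        second sum has the index range needed for \<open>p\<close>.\<close>
      also have "(\<Sum>i\<le>n. coeff q i *s (T ^^ i) u) = (\<Sum>i\<le>Suc n. coeff q i *s (T ^^ i) u)"
        using dq by (simp add: coeff_eq_0)
      also have "(\<Sum>i\<le>n. coeff q i *s (T ^^ Suc i) u) - c *s \<dots> = (\<Sum>i\<le>Suc n. coeff p i *s (T ^^ i) u)"
        unfolding sum.atMost_Suc_shift cs
        by (simp add: scale_left_diff_distrib scale_right_distrib sum_subtractf scale_sum_right)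
      finally have "(\<Sum>i\<le>n. coeff q i *s (T ^^ i) (shift T c u)) = 0"
        using Suc.prems by simp
      then have "shift T c u \<in> ?W"
        using Suc.IH[OF dq q] shiftU Suc.prems by blast
      then show ?thesis using pull Suc.prems by blast
    qed
  qed
  obtain a n where a: "\<exists>i\<le>n. a i \<noteq> 0" "(\<Sum>i\<le>n. a i *s (T ^^ i) v) = 0"
    by (rule ex_annihilating_coeffs)
  define p where "p = (\<Sum>i\<le>n. monom (a i) i)"
  have cp: "coeff p i = (if i \<le> n then a i else 0)" for i
    by (simp add: p_def coeff_sum if_distrib cong: if_cong)
  show ?thesis
  proof (rule main[of p n])
    show "degree p \<le> n" by (rule degree_le) (simp add: cp)
    show "p \<noteq> 0" using a(1) cp by (metis coeff_0)
    show "(\<Sum>i\<le>n. coeff p i *s (T ^^ i) v) = 0" using a(2) by (simp add: cp)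
  qed (rule v)
qed

text \<open>Instead of ordering the basis, it suffices that \<open>(T - c) b\<close> has no
  component along \<open>b\<close>, so that \<open>c\<close> is the diagonal entry of
  \<open>T\<close> at \<open>b\<close>. A largest independent set with this property spans:
  otherwise a generalized eigenvector outside its span, moved into the span by \<open>T - c\<close>,
  could be added.\<close>

lemma ex_triangular_basis:
  assumes T: "endo T"
  obtains B where "independent B" "span B = UNIV"
    "\<And>b. b \<in> B \<Longrightarrow> \<exists>c. b \<in> gen_eigenspace T c \<and> shift T c b \<in> span (B \<inter> gen_eigenspace T c - {b})"
proof -
  define Q where "Q B \<longleftrightarrow> independent B \<and> (\<forall>b\<in>B. \<exists>c. b \<in> gen_eigenspace T c \<and>
    shift T c b \<in> span (B \<inter> gen_eigenspace T c - {b}))" for B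
  have "Q {}" by (simp add: Q_def independent_empty)
  moreover have "card B < Suc dimension" if "Q B" for B
    using that independent_bound_general dim_subset_UNIV unfolding Q_def
    by (meson le_imp_less_Suc le_trans)
  ultimately obtain B where B: "Q B" and max: "\<And>C. Q C \<Longrightarrow> card C \<le> card B"
    using ex_has_greatest_nat[of Q "{}" card "Suc dimension"] by blast
  have indep: "independent B" and finB: "finite B"
    using B finiteI_independent by (auto simp: Q_def)
  have ev: "B \<subseteq> (\<Union>c. gen_eigenspace T c)" using B by (auto simp: Q_def)
  have "gen_eigenspace T c \<subseteq> span B" for c
  proof (rule ccontr)
    assume "\<not> gen_eigenspace T c \<subseteq> span B"
    then obtain v where "v \<in> gen_eigenspace T c" "v \<notin> span B" by blast
    then obtain u where u: "u \<in> gen_eigenspace T c" "u \<notin> span B" "shift T c u \<in> span B"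
      using gen_eigenspace_leave[of v T c "span B" UNIV] span_zero by blast
    have "shift T c u \<in> span (B \<inter> gen_eigenspace T c)"
      by (rule gen_eigenspace_inter_span[OF T ev u(3) shift_gen_eigenspace[OF T u(1)]])
    moreover have "u \<notin> B" using u span_base by blast
    ultimately have new: "shift T c u \<in> span (insert u B \<inter> gen_eigenspace T c - {u})"
      by (simp add: Int_insert_left insert_Diff_if)
    have "Q (insert u B)"
      unfolding Q_def
    proof (intro conjI ballI)
      show "independent (insert u B)" using u(2) indep by (simp add: independent_insert)
      fix b assume "b \<in> insert u B"
      then show "\<exists>c. b \<in> gen_eigenspace T c \<and> shift T c b \<in> span (insert u B \<inter> gen_eigenspace T c - {b})"
      proof
        assume "b \<in> B"
        then obtain d where "b \<in> gen_eigenspace T d"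
          "shift T d b \<in> span (B \<inter> gen_eigenspace T d - {b})"
          using B by (auto simp: Q_def)
        moreover have "span (B \<inter> gen_eigenspace T d - {b}) \<subseteq>
            span (insert u B \<inter> gen_eigenspace T d - {b})" by (intro span_mono) blast
        ultimately show ?thesis by blast
      qed (use u new in blast)
    qed
    then show False using max[of "insert u B"] finB \<open>u \<notin> B\<close> by simp
  qed
  then have "span (\<Union>c. gen_eigenspace T c \<inter> UNIV) \<subseteq> span B"
    by (intro span_minimal) auto
  then have "span B = UNIV"
    using span_gen_eigenspaces[OF T subspace_UNIV] by auto
  then show thesis using that B by (auto simp: Q_def)
qed

text \<open>Prescribe the scalars on a basis of generalized eigenvectors; each eigenspace is spanned
  by the basis vectors it contains. Taking \<open>f\<close> to be the identity gives the semisimple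
  part of \<open>T\<close>; complex conjugation is the other choice used.\<close>

lemma ex_spectral_map:
  assumes T: "endo T"
  obtains D where "endo D" "\<And>c v. v \<in> gen_eigenspace T c \<Longrightarrow> D v = f c *s v"
proof -
  obtain B where B: "independent B" "span B = UNIV"
    and ex: "\<And>b. b \<in> B \<Longrightarrow> \<exists>c. b \<in> gen_eigenspace T c \<and> shift T c b \<in> span (B \<inter> gen_eigenspace T c - {b})"
    using ex_triangular_basis[OF T] by blast
  then obtain ev where ev: "\<And>b. b \<in> B \<Longrightarrow> b \<in> gen_eigenspace T (ev b)" by metis
  obtain D where D: "endo D" "\<forall>b\<in>B. D b = f (ev b) *s b"
    using pair.linear_independent_extend[OF B(1), of "\<lambda>b. f (ev b) *s b"] by blast
  have "D v = f c *s v" if v: "v \<in> gen_eigenspace T c" for c v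
  proof (rule pair.linear_eq_on[OF D(1)])
    show "endo (\<lambda>v. f c *s v)" by (simp add: endo_iff algebra_simps)
    show "v \<in> span (B \<inter> gen_eigenspace T c)"
      by (rule gen_eigenspace_inter_span[OF T]) (use ev B v in auto)
    fix b assume b: "b \<in> B \<inter> gen_eigenspace T c"
    then have "b \<noteq> 0" using B(1) dependent_zero by blast
    then have "ev b = c" using gen_eigenvalue_unique[OF T] ev b by blast
    then show "D b = f c *s b" using D b by simp
  qed
  then show thesis using that D by blast
qed

text \<open>\<open>U\<close> is the sum of its intersections with the generalized eigenspaces, and
  \<open>D\<close> is scalar on each of them.\<close>

lemma spectral_map_stable:
  assumes T: "endo T" and U: "subspace U" "\<And>u. u \<in> U \<Longrightarrow> T u \<in> U" and v: "v \<in> U"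
    and D: "endo D" "\<And>c v. v \<in> gen_eigenspace T c \<Longrightarrow> D v = f c *s v"
  shows "D v \<in> U"
proof -
  have "D v \<in> span (\<Union>c. gen_eigenspace T c \<inter> U)"
  proof (rule endo_span_stable[OF D(1) _ span_gen_eigenspaces[OF T U v]])
    fix b assume "b \<in> (\<Union>c. gen_eigenspace T c \<inter> U)"
    moreover from this obtain c where "D b = f c *s b" using D(2) by blast
    ultimately show "D b \<in> span (\<Union>c. gen_eigenspace T c \<inter> U)"
      by (metis span_base span_scale)
  qed
  moreover have "span (\<Union>c. gen_eigenspace T c \<inter> U) \<subseteq> U"
    by (intro span_minimal U) auto
  ultimately show ?thesis by blast
qed

section \<open>The trace\<close>

definition trace_wrt :: "'a set \<Rightarrow> ('a \<Rightarrow> 'a) \<Rightarrow> complex" where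
  "trace_wrt B X = (\<Sum>b\<in>B. representation B (X b) b)"

text \<open>Both sides are the same double sum of products of matrix entries over \<open>B\<close>
  and \<open>C\<close>. Allowing two bases yields independence of the basis (one map the identity)
  and cyclicity (equal bases) at once.\<close>

lemma trace_wrt_swap:
  assumes B: "independent B" "span B = UNIV" and C: "independent C" "span C = UNIV"
    and X: "endo X" and Y: "endo Y"
  shows "trace_wrt B (\<lambda>v. X (Y v)) = trace_wrt C (\<lambda>v. Y (X v))"
proof -
  have expand: "trace_wrt B (\<lambda>v. X (Y v)) =
      (\<Sum>b\<in>B. \<Sum>c\<in>C. representation C (Y b) c * representation B (X c) b)"
    if B: "independent B" "span B = UNIV" and C: "independent C" "span C = UNIV"
    and X: "endo X" for B C X Y
    unfolding trace_wrt_def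
  proof (rule sum.cong[OF refl])
    fix b assume "b \<in> B"
    have "Y b = (\<Sum>c\<in>C. representation C (Y b) c *s c)"
      using C finiteI_independent by (subst sum_representation_eq[of C]) auto
    then have "X (Y b) = (\<Sum>c\<in>C. representation C (Y b) c *s X c)"
      by (metis (no_types, lifting) endo_scale[OF X] endo_sum[OF X] sum.cong)
    then show "representation B (X (Y b)) b = (\<Sum>c\<in>C. representation C (Y b) c * representation B (X c) b)"
      using B by (simp add: representation_sum representation_scale)
  qed
  show ?thesis
    unfolding expand[OF B C X] expand[OF C B Y]
    by (subst sum.swap) (simp add: mult.commute)
qed

abbreviation trace :: "('a \<Rightarrow> 'a) \<Rightarrow> complex" where
  "trace \<equiv> trace_wrt Basis"

lemma trace_wrt_eq_trace:
  assumes "independent B" "span B = UNIV" "endo X"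
  shows "trace_wrt B X = trace X"
  using trace_wrt_swap[OF assms(1,2) independent_Basis span_Basis assms(3), of "\<lambda>v. v"]
  by (simp add: endo_iff)

lemma trace_commute: "endo X \<Longrightarrow> endo Y \<Longrightarrow> trace (\<lambda>v. X (Y v)) = trace (\<lambda>v. Y (X v))"
  by (rule trace_wrt_swap[OF independent_Basis span_Basis independent_Basis span_Basis])

lemma trace_add: "trace (\<lambda>v. X v + Y v) = trace X + trace Y"
  by (simp add: trace_wrt_def representation_add independent_Basis span_Basis sum.distrib)

lemma trace_diff: "trace (\<lambda>v. X v - Y v) = trace X - trace Y"
  by (simp add: trace_wrt_def representation_diff independent_Basis span_Basis sum_subtractf)

lemma trace_scale: "trace (\<lambda>v. c *s X v) = c * trace X"
  by (simp add: trace_wrt_def representation_scale independent_Basis span_Basis sum_distrib_left)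

text \<open>In a triangular basis the diagonal entries of \<open>D \<circ> T\<close> are the squared
  moduli of the eigenvalues. Their sum is 0, so every eigenvalue is 0.\<close>

lemma gen_eigenspace_0_if_trace_0:
  assumes T: "endo T" and D: "endo D" "\<And>c v. v \<in> gen_eigenspace T c \<Longrightarrow> D v = cnj c *s v"
    and tr: "trace (\<lambda>v. D (T v)) = 0"
  shows "gen_eigenspace T 0 = UNIV"
proof -
  obtain B where B: "independent B" "span B = UNIV"
    and ex: "\<And>b. b \<in> B \<Longrightarrow> \<exists>c. b \<in> gen_eigenspace T c \<and> shift T c b \<in> span (B \<inter> gen_eigenspace T c - {b})"
    using ex_triangular_basis[OF T] by blast
  then obtain ev where ev: "\<And>b. b \<in> B \<Longrightarrow> b \<in> gen_eigenspace T (ev b)"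
    and tri: "\<And>b. b \<in> B \<Longrightarrow> shift T (ev b) b \<in> span (B \<inter> gen_eigenspace T (ev b) - {b})" by metis
  have "representation B (D (T b)) b = of_real ((cmod (ev b))\<^sup>2)" if b: "b \<in> B" for b
  proof -
    let ?r = "shift T (ev b) b"
    have "T b = ev b *s b + ?r" by (simp add: shift_def)
    then have "D (T b) = D (ev b *s b) + D ?r" by (metis endo_add[OF D(1)])
    also have "\<dots> = (ev b * cnj (ev b)) *s b + cnj (ev b) *s ?r"
      using D ev[OF b] shift_gen_eigenspace[OF T ev[OF b]] by (simp add: endo_scale[OF D(1)])
    finally have "representation B (D (T b)) b
        = ev b * cnj (ev b) * representation B b b + cnj (ev b) * representation B ?r b"
      using B by (simp add: representation_add representation_scale)
    moreover have "representation B ?r b = 0"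
    proof -
      have sub: "B \<inter> gen_eigenspace T (ev b) - {b} \<subseteq> B" by blast
      show ?thesis
        using representation_extend[OF B(1) tri[OF b] sub] representation_ne_zero by force
    qed
    ultimately show ?thesis
      using B b by (simp add: representation_basis complex_norm_square del: of_real_power)
  qed
  then have "trace_wrt B (\<lambda>v. D (T v)) = of_real (\<Sum>b\<in>B. (cmod (ev b))\<^sup>2)"
    by (simp add: trace_wrt_def)
  moreover have "endo (\<lambda>v. D (T v))" using T D by (simp add: endo_iff)
  ultimately have "(\<Sum>b\<in>B. (cmod (ev b))\<^sup>2) = 0"
    using tr trace_wrt_eq_trace[OF B] by (metis of_real_eq_0_iff)
  then have "ev b = 0" if "b \<in> B" for b
    using that sum_nonneg_eq_0_iff[of B "\<lambda>b. (cmod (ev b))\<^sup>2"] finiteI_independent[OF B(1)] by simp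
  then have "span B \<subseteq> gen_eigenspace T 0"
    using ev by (intro span_minimal subspace_gen_eigenspace[OF T]) force
  then show ?thesis using B by blast
qed

end

section \<open>Killing form and derivations\<close>

locale complex_fd_lie_algebra = complex_lie_algebra scale bracket + complex_fd_space scale Basis
  for scale :: "complex \<Rightarrow> 'a::ab_group_add \<Rightarrow> 'a" (infixr "*s" 75) and bracket Basis
begin

lemma endo_ad: "endo (bracket x)"
  by (rule linear_bracket_right)

lemmas bracket_right = endo_add[OF endo_ad] endo_scale[OF endo_ad] endo_zero[OF endo_ad]
  endo_diff[OF endo_ad]

lemmas bracket_left = endo_add[OF linear_bracket_left] endo_scale[OF linear_bracket_left]
  endo_zero[OF linear_bracket_left] endo_diff[OF linear_bracket_left]

lemma bracket_antisym: "bracket x y = - bracket y x"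
proof -
  have "0 = bracket (x + y) (x + y)" by (simp only: bracket_self)
  also have "\<dots> = bracket x y + bracket y x"
    unfolding bracket_left bracket_right by (simp add: bracket_self)
  finally show ?thesis by (simp add: eq_neg_iff_add_eq_0)
qed

lemma bracket_mem_swap: "subspace V \<Longrightarrow> bracket x y \<in> V \<longleftrightarrow> bracket y x \<in> V"
  using bracket_antisym[of x y] bracket_antisym[of y x] subspace_neg by metis

lemma bracket_minus_right: "bracket x (- y) = - bracket x y"
  using bracket_right(4)[of x 0 y] by (simp add: bracket_right)

lemma ad_derivation: "bracket x (bracket y z) = bracket (bracket x y) z + bracket y (bracket x z)"
  using jacobi[of x y z] bracket_antisym[of z "bracket x y"] bracket_antisym[of z x]
  by (simp add: bracket_minus_right algebra_simps)

lemma ad_bracket: "bracket (bracket x y) z = bracket x (bracket y z) - bracket y (bracket x z)"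
  by (simp add: ad_derivation[of x y z])

definition derivation :: "('a \<Rightarrow> 'a) \<Rightarrow> bool" where
  "derivation D \<longleftrightarrow> endo D \<and> (\<forall>x y. D (bracket x y) = bracket (D x) y + bracket x (D y))"

text \<open>By the Leibniz rule, \<open>ad x - (c + d)\<close> sends \<open>[u, v]\<close> to
  \<open>[(ad x - c) u, v] + [u, (ad x - d) v]\<close>. The nested induction replaces the binomial
  formula for its powers.\<close>

lemma bracket_gen_eigenspaces:
  assumes "u \<in> gen_eigenspace (bracket x) c" "v \<in> gen_eigenspace (bracket x) d"
  shows "bracket u v \<in> gen_eigenspace (bracket x) (c + d)"
  using assms
proof (induction arbitrary: v)
  case zero
  then show ?case by (simp add: bracket_left gen_eigenspace.zero)
next
  case (step u)
  from step.prems show ?case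
  proof induction
    case zero
    then show ?case by (simp add: bracket_right gen_eigenspace.zero)
  next
    case (step v)
    have "shift (bracket x) (c + d) (bracket u v) =
        bracket (shift (bracket x) c u) v + bracket u (shift (bracket x) d v)"
      by (simp add: shift_def bracket_left bracket_right ad_derivation[of x u v] scale_left_distrib)
    also have "\<dots> \<in> gen_eigenspace (bracket x) (c + d)"
      using step \<open>\<And>v. v \<in> gen_eigenspace (bracket x) d \<Longrightarrow>
        bracket (shift (bracket x) c u) v \<in> gen_eigenspace (bracket x) (c + d)\<close>
      by (intro subspace_add subspace_gen_eigenspace endo_ad) (blast intro: gen_eigenspace.step)+
    finally show ?case by (rule gen_eigenspace.step)
  qed
qed

text \<open>On eigenspaces for \<open>c\<close> and \<open>d\<close> both sides of the Leibniz rule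
  are \<open>f (c + d)\<close> times \<open>[u, v]\<close>. Linearity extends this one argument at a
  time.\<close>

lemma spectral_map_derivation:
  assumes D: "endo D" "\<And>c v. v \<in> gen_eigenspace (bracket x) c \<Longrightarrow> D v = f c *s v"
    and f: "\<And>c d. f (c + d) = f c + f d"
  shows "derivation D"
proof -
  let ?G = "\<Union>c. gen_eigenspace (bracket x) c"
  have span: "v \<in> span ?G" for v
    using span_gen_eigenspaces[OF endo_ad subspace_UNIV, of x v] by simp
  have 1: "endo (\<lambda>v. D (bracket u v))" "endo (\<lambda>v. bracket (D u) v + bracket u (D v))"
    "endo (\<lambda>v. D (bracket v u))" "endo (\<lambda>v. bracket (D v) u + bracket v (D u))" for u
    using D(1) by (simp_all add: endo_iff bracket_left bracket_right algebra_simps)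
  have GG: "D (bracket u v) = bracket (D u) v + bracket u (D v)" if uv: "u \<in> ?G" "v \<in> ?G" for u v
  proof -
    obtain c d where cd: "u \<in> gen_eigenspace (bracket x) c" "v \<in> gen_eigenspace (bracket x) d"
      using uv by blast
    show ?thesis
      using D(2)[OF cd(1)] D(2)[OF cd(2)] D(2)[OF bracket_gen_eigenspaces[OF cd]]
      by (simp add: f bracket_left bracket_right scale_left_distrib)
  qed
  have G: "D (bracket u v) = bracket (D u) v + bracket u (D v)" if "u \<in> ?G" for u v
    using pair.linear_eq_on[OF 1(1,2) span] GG that by blast
  have "D (bracket u v) = bracket (D u) v + bracket u (D v)" for u v
    using pair.linear_eq_on[OF 1(3,4) span] G by blast
  then show ?thesis using D(1) by (simp add: derivation_def)
qed

definition killing :: "'a \<Rightarrow> 'a \<Rightarrow> complex" where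
  "killing x y = trace (\<lambda>v. bracket x (bracket y v))"

lemma endo_comp: "endo X \<Longrightarrow> endo Y \<Longrightarrow> endo (\<lambda>v. X (Y v))"
  by (simp add: endo_iff)

text \<open>For a derivation, \<open>ad (D y) = D \<circ> ad y - ad y \<circ> D\<close>; cyclicity
  of the trace then brings \<open>D\<close> to the front.\<close>

lemma trace_commutator_ad:
  assumes D: "derivation D" and X: "endo X"
  shows "trace (\<lambda>v. bracket (D y) (X v)) =
    trace (\<lambda>v. D (bracket y (X v))) - trace (\<lambda>v. D (X (bracket y v)))"
proof -
  have E: "endo D" and L: "bracket (D y) v = D (bracket y v) - bracket y (D v)" for v
    using D by (simp_all add: derivation_def)
  have "trace (\<lambda>v. bracket y (D (X v))) = trace (\<lambda>v. D (X (bracket y v)))"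
    by (rule trace_commute[OF endo_ad endo_comp[OF E X]])
  then show ?thesis by (simp add: L trace_diff)
qed

text \<open>Expand \<open>ad [y, z]\<close> as a commutator and regroup it around \<open>D\<close>.
  For \<open>D = ad x\<close> this is invariance of the Killing form.\<close>

lemma trace_ad_bracket:
  assumes D: "derivation D"
  shows "trace (\<lambda>v. D (bracket (bracket y z) v)) = killing (D y) z"
proof -
  have E: "endo D" using D by (simp add: derivation_def)
  have "trace (\<lambda>v. D (bracket (bracket y z) v)) =
      trace (\<lambda>v. D (bracket y (bracket z v))) - trace (\<lambda>v. D (bracket z (bracket y v)))"
    by (simp add: ad_bracket endo_diff[OF E] trace_diff)
  also have "\<dots> = killing (D y) z"
    using trace_commutator_ad[OF D endo_ad[of z], of y] by (simp add: killing_def)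
  finally show ?thesis .
qed

lemma derivation_ad: "derivation (bracket x)"
  unfolding derivation_def using endo_ad ad_derivation by blast

lemma killing_invariant: "killing (bracket x y) z = killing x (bracket y z)"
  using trace_ad_bracket[OF derivation_ad[of x], of y z] by (simp add: killing_def)

lemma killing_linear:
  "killing (x + x') y = killing x y + killing x' y" "killing (c *s x) y = c * killing x y"
  "killing x (y + y') = killing x y + killing x y'" "killing x (c *s y) = c * killing x y"
  by (simp_all add: killing_def bracket_left bracket_right trace_add trace_scale)

text \<open>By non-degeneracy the functional sending \<open>y\<close> to the trace of
  \<open>D \<circ> ad y\<close> is \<open>killing s\<close> for some \<open>s\<close>. Then
  \<open>killing (D y) z = killing s [y, z] = killing [s, y] z\<close> for all \<open>z\<close>, so
  \<open>D y = [s, y]\<close>.\<close>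

lemma inner_derivation:
  assumes nondeg: "\<And>x. (\<And>y. killing x y = 0) \<Longrightarrow> x = 0" and D: "derivation D"
  obtains s where "D = bracket s"
proof -
  have E: "endo D" using D by (simp add: derivation_def)
  \<comment> \<open>\<open>K s\<close> stores the values of \<open>killing s\<close> on
    \<open>Basis\<close> as coordinates of a vector, making \<open>K\<close> an endomorphism, for
    which injectivity implies surjectivity.\<close>
  define K where "K s = (\<Sum>b\<in>Basis. killing s b *s b)" for s
  have coeff: "u b = v b" if "(\<Sum>b\<in>Basis. u b *s b) = (\<Sum>b\<in>Basis. v b *s b)" "b \<in> Basis" for u v b
    using independentD[OF independent_Basis finite_Basis order_refl, of "\<lambda>b. u b - v b" b] that
    by (simp add: scale_left_diff_distrib sum_subtractf)
  have ext: "g y = h y" if "\<And>b. b \<in> Basis \<Longrightarrow> g b = h b"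
    "\<And>x y. g (x + y) = g x + g y" "\<And>c x. g (c *s x) = c * g x"
    "\<And>x y. h (x + y) = h x + h y" "\<And>c x. h (c *s x) = c * h x" for g h :: "'a \<Rightarrow> complex" and y
  proof -
    have z: "g 0 = 0" "h 0 = 0" using that(3)[of 0 0] that(5)[of 0 0] by simp_all
    have "y \<in> span Basis" by (simp add: span_Basis)
    then show ?thesis by (induction rule: span_induct_alt) (simp_all add: that z)
  qed
  have endo_K: "endo K"
    by (simp add: endo_iff K_def killing_linear scale_left_distrib sum.distrib scale_sum_right)
  have "inj K"
    unfolding pair.linear_inj_iff_eq_0[OF endo_K]
  proof (intro allI impI)
    fix s assume "K s = 0"
    then have 0: "killing s b = 0" if "b \<in> Basis" for b
      using coeff[of "killing s" "\<lambda>_. 0" b] that by (simp add: K_def)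
    have "killing s y = 0" for y
      by (rule ext[of "killing s" "\<lambda>_. 0"]) (simp_all add: 0 killing_linear)
    then show "s = 0" by (rule nondeg)
  qed
  then have "surj K" using linear_inj_imp_surj endo_K by blast
  then obtain s where s: "K s = (\<Sum>b\<in>Basis. trace (\<lambda>v. D (bracket b v)) *s b)"
    by (metis surjD)
  have s': "killing s y = trace (\<lambda>v. D (bracket y v))" for y
  proof (rule ext)
    fix b assume "b \<in> Basis"
    then show "killing s b = trace (\<lambda>v. D (bracket b v))"
      using coeff[OF s[unfolded K_def]] by blast
  qed (simp_all add: killing_linear bracket_left endo_add[OF E] endo_scale[OF E] trace_add trace_scale)
  have "D y - bracket s y = 0" for y
  proof (rule nondeg)
    fix z
    have "killing (D y) z = killing (bracket s y) z"
      by (simp add: trace_ad_bracket[OF D, symmetric] killing_invariant s')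
    then show "killing (D y - bracket s y) z = 0"
      using killing_linear(1)[of "D y - bracket s y" "bracket s y" z] by simp
  qed
  then have "D y = bracket s y" for y by simp
  then show thesis by (intro that[of s]) blast
qed

section \<open>Engel's theorem\<close>

text \<open>Since \<open>[x, x] = 0\<close>, all brackets within \<open>M\<close> plus the line of
  \<open>x\<close> already fall into \<open>M\<close>. This serves both Engel's theorem and the use
  of saturation.\<close>

lemma subalgebra_insert:
  assumes M: "lie_subalgebra M" and x: "\<And>m. m \<in> M \<Longrightarrow> bracket m x \<in> M"
  shows "lie_subalgebra (span (insert x M))" "ideal_of M (span (insert x M))"
proof -
  have V: "subspace M" and cl: "\<And>y z. y \<in> M \<Longrightarrow> z \<in> M \<Longrightarrow> bracket y z \<in> M"
    using M by (auto simp: lie_subalgebra_def)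
  have x': "bracket x m \<in> M" if "m \<in> M" for m
    using x[OF that] bracket_mem_swap[OF V] by blast
  have dec: "\<exists>m\<in>M. \<exists>k. y = m + k *s x" if y: "y \<in> span (insert x M)" for y
  proof -
    obtain k where "y - k *s x \<in> M"
      using y V by (auto simp: span_insert span_eq_iff[THEN iffD2])
    then show ?thesis by (intro bexI[of _ "y - k *s x"] exI[of _ k]) auto
  qed
  have MM: "M \<subseteq> span (insert x M)" by (auto intro: span_base)
  have br: "bracket y z \<in> M" if yz: "y \<in> span (insert x M)" "z \<in> span (insert x M)" for y z
  proof -
    obtain m k m' k' where "m \<in> M" "y = m + k *s x" "m' \<in> M" "z = m' + k' *s x"
      using dec[OF yz(1)] dec[OF yz(2)] by blast
    then show ?thesis
      using V cl x x'
      by (auto simp: bracket_left bracket_right bracket_self intro!: subspace_add subspace_scale)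
  qed
  show 1: "lie_subalgebra (span (insert x M))"
    using br MM by (auto simp: lie_subalgebra_def)
  show "ideal_of M (span (insert x M))"
    using 1 V MM br by (auto simp: ideal_of_def)
qed

text \<open>
  A subalgebra of maximal dimension with the common-null-vector property \<open>P\<close> in all quotients must
  be everything: \<open>P\<close> applied to the quotient by the subalgebra itself gives a larger one.
\<close>

lemma engel:
  assumes nil: "\<And>x. gen_eigenspace (bracket x) 0 = UNIV" and ne: "(UNIV :: 'a set) \<noteq> {0}"
  obtains z where "z \<noteq> 0" "\<And>x. bracket x z = 0"
proof -
  define P where "P M \<longleftrightarrow> lie_subalgebra M \<and> (\<forall>W. subspace W \<and> W \<noteq> UNIV \<and>
    (\<forall>m\<in>M. \<forall>w\<in>W. bracket m w \<in> W) \<longrightarrow> (\<exists>v. v \<notin> W \<and> (\<forall>m\<in>M. bracket m v \<in> W)))" for M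
  have "P {0}"
    by (auto simp: P_def lie_subalgebra_def bracket_left subspace_0 subspace_single_0)
  moreover have "dim M < Suc dimension" for M
    using dim_subset_UNIV[of M] by simp
  ultimately obtain M where M: "P M" and max: "\<And>N. P N \<Longrightarrow> dim N \<le> dim M"
    using ex_has_greatest_nat[of P "{0}" dim "Suc dimension"] by blast
  then have sub: "lie_subalgebra M" and V: "subspace M" by (auto simp: P_def lie_subalgebra_def)
  have "M = UNIV"
  proof (rule ccontr)
    assume "M \<noteq> UNIV"
    then obtain x where x: "x \<notin> M" "\<And>m. m \<in> M \<Longrightarrow> bracket m x \<in> M"
      using M unfolding P_def lie_subalgebra_def by blast
    let ?N = "span (insert x M)"
    have "P ?N"
      unfolding P_def
    proof (intro conjI allI impI)
      show "lie_subalgebra ?N" by (rule subalgebra_insert[OF sub x(2)])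
      fix W assume "subspace W \<and> W \<noteq> UNIV \<and> (\<forall>m\<in>?N. \<forall>w\<in>W. bracket m w \<in> W)"
      then have W: "subspace W" "W \<noteq> UNIV" and NW: "\<And>m w. m \<in> ?N \<Longrightarrow> w \<in> W \<Longrightarrow> bracket m w \<in> W"
        by auto
      have MN: "M \<subseteq> ?N" and xN: "x \<in> ?N" by (auto intro: span_base)
      define V' where "V' = {v. \<forall>m\<in>M. bracket m v \<in> W}"
      obtain v where v: "v \<notin> W" "v \<in> V'"
        using M W NW MN unfolding P_def V'_def by blast
      \<comment> \<open>In \<open>[m, [x, u]] = [[m, x], u] + [x, [m, u]]\<close> the first term is
        in \<open>W\<close> because \<open>[m, x]\<close> is in \<open>M\<close>, the second because
        \<open>x\<close> preserves \<open>W\<close>.\<close>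
      have stable: "shift (bracket x) 0 u \<in> V'" if "u \<in> V'" for u
        using that x NW[OF xN] W
        by (auto simp: V'_def shift_def ad_derivation[of _ x u] intro!: subspace_add)
      \<comment> \<open>As \<open>ad x\<close> is nilpotent, some iterate of \<open>v\<close> under
        it is the last one outside \<open>W\<close>; it stays in \<open>V'\<close>, and
        \<open>x\<close> sends it into \<open>W\<close>.\<close>
      obtain u where u: "u \<in> V'" "u \<notin> W" "shift (bracket x) 0 u \<in> W"
      proof (rule gen_eigenspace_leave)
        show "v \<in> gen_eigenspace (bracket x) 0" by (simp add: nil)
      qed (use v stable subspace_0[OF W(1)] in auto)
      have "bracket y u \<in> W" if "y \<in> ?N" for y
        using that
      proof (induction rule: span_induct_alt)
        case base
        show ?case using W by (simp add: bracket_left subspace_0)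
      next
        case (step c b y)
        then show ?case
          using u W by (auto simp: bracket_left V'_def shift_def intro!: subspace_add subspace_scale)
      qed
      then show "\<exists>v. v \<notin> W \<and> (\<forall>m\<in>?N. bracket m v \<in> W)" using u by blast
    qed
    then have "dim ?N \<le> dim M" by (rule max)
    then show False using x(1) V by (simp add: dim_insert span_eq_iff[THEN iffD2])
  qed
  with M have "subspace {0} \<and> {0} \<noteq> (UNIV :: 'a set) \<and> (\<forall>m\<in>UNIV. \<forall>w\<in>{0}. bracket m w \<in> {0}) \<longrightarrow>
      (\<exists>v. v \<notin> {0} \<and> (\<forall>m\<in>UNIV. bracket m v \<in> {0}))"
    unfolding P_def by blast
  then have "\<exists>v. v \<noteq> 0 \<and> (\<forall>m. bracket m v = 0)"
    using ne by (simp add: bracket_right subspace_single_0 eq_commute[of "{0}"])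
  then show thesis using that by blast
qed

end

section \<open>Simple Lie algebras: non-degenerate Killing form and semisimple principal
  elements\<close>

locale simple_complex_fd_lie_algebra = simple_complex_lie_algebra scale bracket
    + complex_fd_lie_algebra scale bracket Basis
  for scale :: "complex \<Rightarrow> 'a::ab_group_add \<Rightarrow> 'a" (infixr "*s" 75) and bracket Basis
begin

lemma ideal_UNIV_iff: "ideal_of I UNIV \<longleftrightarrow> subspace I \<and> (\<forall>x. \<forall>y\<in>I. bracket x y \<in> I)"
  by (auto simp: ideal_of_def lie_subalgebra_def)

lemma span_brackets: "span {bracket y z | y z. True} = UNIV"
proof -
  have "ideal_of (span {bracket y z | y z. True}) UNIV"
    unfolding ideal_UNIV_iff by (auto intro: span_base)
  moreover have "span {bracket y z | y z. True} \<noteq> {0}"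
    using nonabelian span_base[of _ "{bracket y z | y z. True}"] by blast
  ultimately show ?thesis using ideal_trivial by blast
qed

lemma center_trivial:
  assumes "\<And>x. bracket x z = 0"
  shows "z = 0"
proof -
  have "ideal_of {z. \<forall>x. bracket x z = 0} UNIV"
    unfolding ideal_UNIV_iff by (auto simp: subspace_def bracket_right)
  moreover have "{z. \<forall>x. bracket x z = 0} \<noteq> UNIV" using nonabelian by blast
  ultimately show ?thesis using ideal_trivial assms by blast
qed

lemma killing_nondegenerate:
  assumes "\<And>y. killing x y = 0"
  shows "x = 0"
proof -
  let ?R = "{x. \<forall>y. killing x y = 0}"
  have "killing 0 y = 0" for y using killing_linear(2)[of 0 0] by simp
  moreover have "killing (bracket z x) y = 0" if "x \<in> ?R" for x y z
  proof -
    have "killing (bracket z x) y = - killing x (bracket z y)"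
      using killing_linear(2)[of "-1" "bracket x z" y] bracket_antisym[of z x]
      by (simp add: killing_invariant scale_minus_left)
    then show ?thesis using that by simp
  qed
  ultimately have "ideal_of ?R UNIV"
    unfolding ideal_UNIV_iff by (auto simp: subspace_def killing_linear)
  moreover have "?R \<noteq> UNIV"
  proof
    assume "?R = UNIV"
    then have kill0: "killing y z = 0" for y z by blast
    have "gen_eigenspace (bracket x) 0 = UNIV" for x
    proof -
      obtain D where D: "endo D" "\<And>c v. v \<in> gen_eigenspace (bracket x) c \<Longrightarrow> D v = cnj c *s v"
        using ex_spectral_map[OF endo_ad] by blast
      \<comment> \<open>Complex conjugation is additive, which is all that the derivation property
        asks of the eigenvalue function.\<close>
      have der: "derivation D" by (rule spectral_map_derivation[OF D]) auto
      have "trace (\<lambda>v. D (bracket y v)) = 0" for y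
      proof -
        have "y \<in> span {bracket y z | y z. True}" unfolding span_brackets by (rule UNIV_I)
        then show ?thesis
        proof (induction rule: span_induct_alt)
          case base
          show ?case using trace_scale[of 0 "\<lambda>v. v"] by (simp add: bracket_left endo_zero[OF D(1)])
        next
          case (step c b y)
          then obtain y' z' where "b = bracket y' z'" by blast
          then have "trace (\<lambda>v. D (bracket b v)) = 0" by (simp add: trace_ad_bracket[OF der] kill0)
          with step show ?case
            by (simp add: bracket_left endo_add[OF D(1)] endo_scale[OF D(1)] trace_add trace_scale)
        qed
      qed
      then show ?thesis by (intro gen_eigenspace_0_if_trace_0[OF endo_ad D])
    qed
    moreover have "(UNIV :: 'a set) \<noteq> {0}"
      using nonabelian by (metis UNIV_I singletonD)
    ultimately obtain z where "z \<noteq> 0" "\<And>x. bracket x z = 0" using engel by blast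
    then show False using center_trivial by blast
  qed
  ultimately have "?R = {0}" using ideal_trivial by blast
  then show ?thesis using assms by blast
qed

lemma principal_element_semisimple:
  assumes sat: "saturated_frobenius_subalgebra \<ff>" and F: "frobenius_functional \<ff> F"
  shows "semisimple_element (principal_element \<ff> F)"
proof -
  let ?x = "principal_element \<ff> F"
  let ?T = "bracket ?x"
  have sub: "lie_subalgebra \<ff>" and V: "subspace \<ff>"
    using sat by (auto simp: saturated_frobenius_subalgebra_def frobenius_subalgebra_def lie_subalgebra_def)
  note uniq = principal_element_unique_existence[OF sub F]
  have "?x \<in> \<ff> \<and> (\<forall>y\<in>\<ff>. F y = F (?T y))"
    unfolding principal_element_def by (rule theI'[OF uniq])
  then have x: "?x \<in> \<ff>" and Fx: "\<And>y. y \<in> \<ff> \<Longrightarrow> F (?T y) = F y"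
    by metis+
  have Tf: "?T y \<in> \<ff>" if "y \<in> \<ff>" for y
    using sub x that by (simp add: lie_subalgebra_def)
  have Fadd: "F (y + z) = F y + F z" and Fsc: "F (c *s y) = c * F y" if "y \<in> \<ff>" "z \<in> \<ff>" for y z c
    using F that by (auto simp: frobenius_functional_def linear_functional_on_def)
  obtain D where D: "endo D" "\<And>c v. v \<in> gen_eigenspace ?T c \<Longrightarrow> D v = c *s v"
    using ex_spectral_map[OF endo_ad, of ?x "\<lambda>c. c"] by blast
  have "derivation D" by (rule spectral_map_derivation[OF D]) auto
  then obtain s where s: "D = bracket s"
    using inner_derivation killing_nondegenerate by blast
  \<comment> \<open>This says that \<open>s\<close> normalizes \<open>\<ff>\<close>; if
    \<open>s\<close> were outside, \<open>\<ff>\<close> would be an ideal of the larger subalgebra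
    spanned by \<open>s\<close> and \<open>\<ff>\<close>.\<close>
  have Df: "D y \<in> \<ff>" if "y \<in> \<ff>" for y
    by (rule spectral_map_stable[OF endo_ad V Tf that D])
  have "s \<in> \<ff>"
  proof (rule ccontr)
    assume "s \<notin> \<ff>"
    then have "\<ff> \<subset> span (insert s \<ff>)" by (auto intro: span_base)
    moreover have "bracket m s \<in> \<ff>" if "m \<in> \<ff>" for m
      using Df[OF that] bracket_mem_swap[OF V] by (simp add: s)
    ultimately show False
      using subalgebra_insert[OF sub] sat by (auto simp: saturated_frobenius_subalgebra_def)
  qed
  moreover have "F y = F (bracket s y)" if y: "y \<in> \<ff>" for y
  proof -
    have "y \<in> span (\<Union>c. gen_eigenspace ?T c \<inter> \<ff>)"
      by (rule span_gen_eigenspaces[OF endo_ad V Tf y])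
    then have "y \<in> \<ff> \<and> F y = F (D y)"
    proof (induction rule: span_induct_alt)
      case base
      show ?case using V by (simp add: subspace_0 endo_zero[OF D(1)])
    next
      case (step k b y)
      then obtain c where b: "b \<in> gen_eigenspace ?T c" "b \<in> \<ff>" by blast
      have "F b = F (D b)"
      proof (cases "c = 1")
        case True
        then show ?thesis using D(2)[OF b(1)] by simp
      next
        case False
        \<comment> \<open>For \<open>c \<noteq> 1\<close>, \<open>T - 1\<close> is onto on the part
          of the eigenspace inside \<open>\<ff>\<close>, and \<open>F\<close> kills the image of
          \<open>T - 1\<close> on \<open>\<ff>\<close>; hence \<open>F b = 0\<close>.\<close>
        then obtain u where u: "u \<in> \<ff>" "shift ?T 1 u = b"
          using shift_surj_gen_eigenspace[OF endo_ad V Tf _ b, of 1] by metis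
        then have "?T u = b + u" by (simp add: shift_def algebra_simps)
        then have "F b = 0" using Fx[OF u(1)] Fadd[OF b(2) u(1)] by simp
        then show ?thesis using D(2)[OF b(1)] Fsc[OF b(2) b(2)] by simp
      qed
      then show ?case
        using step b V Df
        by (simp add: endo_add[OF D(1)] endo_scale[OF D(1)] Fadd Fsc subspace_add subspace_scale)
    qed
    then show ?thesis by (simp add: s)
  qed
  ultimately have "?x = s"
    using uniq x Fx by (metis (no_types, lifting))
  obtain B where B: "independent B" "span B = UNIV"
    "\<And>b. b \<in> B \<Longrightarrow> \<exists>c. b \<in> gen_eigenspace ?T c \<and> shift ?T c b \<in> span (B \<inter> gen_eigenspace ?T c - {b})"
    using ex_triangular_basis[OF endo_ad] by blast
  \<comment> \<open>Only membership of the basis vectors in generalized eigenspaces matters here: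
    \<open>D = ad s\<close> acts on each as a scalar.\<close>
  then have "\<forall>b\<in>B. \<exists>c. bracket s b = c *s b" using D(2) s by metis
  then show ?thesis
    unfolding semisimple_element_def diagonalizable_def \<open>?x = s\<close> using B by blast
qed

end

theorem theorem1:
  fixes scale :: "complex \<Rightarrow> 'a::ab_group_add \<Rightarrow> 'a"
    and bracket :: "'a \<Rightarrow> 'a \<Rightarrow> 'a"
    and \<ff> :: "'a set"
    and F :: "'a \<Rightarrow> complex"
  assumes "simple_complex_lie_algebra scale bracket"
    and "complex_lie_algebra.saturated_frobenius_subalgebra scale bracket \<ff>"
    and "complex_lie_algebra.frobenius_functional scale bracket \<ff> F"
  shows "complex_lie_algebra.semisimple_element scale bracket
           (complex_lie_algebra.principal_element bracket \<ff> F)"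
proof -
  interpret simple_complex_lie_algebra scale bracket by fact
  obtain Basis where "finite_dimensional_vector_space scale Basis"
    using finite_dimensional by blast
  then interpret finite_dimensional_vector_space scale Basis .
  interpret simple_complex_fd_lie_algebra scale bracket Basis by unfold_locales
  show ?thesis using assms(2,3) by (rule principal_element_semisimple)
qed

end
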